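(* Assume the decay of correlations assumption (DC) stated in the context. Let $d\ge 1$, let $g_j:\mathcal Y_j\to\mathbb R^d$, $j\ge 0$, be measurable functions, let $r:\mathcal E\to[0,\infty)$ be measurable with $\int r\,d\mu=1$, and let $\nu$ be the probability measure $d\nu=r\,d\mu$. Let $S_n=\sum_{j=0}^{n-1}g_j\circ\overline X_j$, and let $S_{n,\mu}$ and $S_{n,\nu}$ denote the random variable $S_n=S_n(x)$ when $x$ is distributed according to $\mu$ and $\nu$, respectively. Assume that for some two conjugate exponents $p$ and $q$ (i.e. $\frac1p+\frac1q=1$), $r$ lies in the $L^p(\mu)$-closure of $B\cap L^p(\mu)$ and $g_j\circ\overline X_j\in L^q(\mu)$ for all $j\ge 0$. Then for every sequence $(b_n)$ of positive numbers with $\lim_{n\to\infty}b_n=\infty$, the sequence $S_{n,\mu}/b_n$ converges in distribution if and only if $S_{n,\nu}/b_n$ converges in distribution, and in this case both converge to the same limit.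
   Context: $(\mathcal E,\mathcal F,\mu)$ is a probability space, $\mathcal X_0,\mathcal X_1,\dots$ are measurable spaces, and $X_j:\mathcal E\to\mathcal X_j$, $j\ge0$, are measurable maps. Set $\mathcal Y_n=\mathcal X_n\times\mathcal X_{n+1}\times\cdots$ and $\overline X_n(x)=(X_n(x),X_{n+1}(x),X_{n+2}(x),\dots)\in\mathcal Y_n$. Assumption (DC): there is a sequence $(\delta_n)$ converging to $0$ and a set $B$ of real-valued $\mu$-integrable functions on $\mathcal E$ equipped with a "norm" $\|\cdot\|$ (a function $B\to[0,\infty)$) such that for all $n$, all $s\in B$ and all bounded measurable complex-valued functions $f=f(x_n,x_{n+1},\dots)$ on $\mathcal Y_n$, $$\left|\int s\cdot (f\circ\overline X_n)\,d\mu-\int s\,d\mu\cdot\int f\circ\overline X_n\,d\mu\right|\le \|s\|\,\|f\circ\overline X_n\|_{\infty}\,\delta_n,$$ where $\|f\circ\overline X_n\|_\infty$ is the essential supremum with respect to $\mu$. *)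

theory Defs
  imports "HOL-Probability.Probability"
begin

text \<open>
  Exponents range over \<open>[0, \<infinity>]\<close>, so that \<open>1 / \<infinity> = 0\<close> and \<open>1 / 0 = \<infinity>\<close>; hence
  \<open>1 / p + 1 / q = 1\<close> forces \<open>p\<close> and \<open>q\<close> to lie in \<open>[1, \<infinity>]\<close>, the endpoint pairs being allowed.
\<close>

definition conjugate_exponents :: "ennreal \<Rightarrow> ennreal \<Rightarrow> bool" where
  "conjugate_exponents p q \<longleftrightarrow> 1 / p + 1 / q = 1"

text \<open>Elements of \<open>L\<^sup>p\<close> are functions, not classes modulo null sets.\<close>

definition Lp_space ::
    "'e measure \<Rightarrow> ennreal \<Rightarrow> ('e \<Rightarrow> 'b::{real_normed_vector, second_countable_topology}) set" where
  "Lp_space M p = {f \<in> borel_measurable M.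
     if p = \<infinity> then esssup M (\<lambda>x. ereal (norm (f x))) < \<infinity>
     else integrable M (\<lambda>x. norm (f x) powr enn2real p)}"

text \<open>The value is meaningful only for members of \<^const>\<open>Lp_space\<close>.\<close>

definition Lp_norm ::
    "'e measure \<Rightarrow> ennreal \<Rightarrow> ('e \<Rightarrow> 'b::{real_normed_vector, second_countable_topology}) \<Rightarrow> real" where
  "Lp_norm M p f =
     (if p = \<infinity> then real_of_ereal (esssup M (\<lambda>x. ereal (norm (f x))))
      else (\<integral>x. norm (f x) powr enn2real p \<partial>M) powr (1 / enn2real p))"

text \<open>The set \<open>A\<close> is expected to be contained in \<open>L\<^sup>p\<close>.\<close>

definition Lp_closure ::
    "'e measure \<Rightarrow> ennreal \<Rightarrow> ('e \<Rightarrow> 'b::{real_normed_vector, second_countable_topology}) set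
      \<Rightarrow> ('e \<Rightarrow> 'b) set" where
  "Lp_closure M p A =
     {f \<in> Lp_space M p. \<forall>\<epsilon>>0. \<exists>s\<in>A. Lp_norm M p (\<lambda>x. f x - s x) < \<epsilon>}"

text \<open>
  The coordinate spaces \<open>\<X>\<^sub>k\<close> are measurable spaces \<open>N k\<close> whose carriers may differ but lie in one
  common type; the product \<open>\<Y>\<^sub>n\<close> of the coordinate spaces from \<open>n\<close> on is indexed so that
  position \<open>k\<close> of a sequence is the coordinate in \<open>\<X>\<^bsub>n + k\<^esub>\<close>.
\<close>

definition tail_space :: "(nat \<Rightarrow> 'x measure) \<Rightarrow> nat \<Rightarrow> (nat \<Rightarrow> 'x) measure" where
  "tail_space N n = (\<Pi>\<^sub>M k\<in>UNIV. N (n + k))"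

definition tail_map :: "(nat \<Rightarrow> 'e \<Rightarrow> 'x) \<Rightarrow> nat \<Rightarrow> 'e \<Rightarrow> (nat \<Rightarrow> 'x)" where
  "tail_map X n x = (\<lambda>k. X (n + k) x)"

text \<open>The function \<open>nrm\<close> is only required to be nonnegative on \<open>B\<close>; no norm axiom is imposed.\<close>

definition decay_of_correlations ::
    "'e measure \<Rightarrow> (nat \<Rightarrow> 'x measure) \<Rightarrow> (nat \<Rightarrow> 'e \<Rightarrow> 'x)
      \<Rightarrow> ('e \<Rightarrow> real) set \<Rightarrow> (('e \<Rightarrow> real) \<Rightarrow> real) \<Rightarrow> (nat \<Rightarrow> real) \<Rightarrow> bool" where
  "decay_of_correlations M N X B nrm \<delta> \<longleftrightarrow>
     \<delta> \<longlonglongrightarrow> 0 \<and>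
     (\<forall>s\<in>B. integrable M s \<and> 0 \<le> nrm s) \<and>
     (\<forall>n. \<forall>s\<in>B. \<forall>f :: (nat \<Rightarrow> 'x) \<Rightarrow> complex.
        f \<in> borel_measurable (tail_space N n) \<and> bounded (f ` space (tail_space N n)) \<longrightarrow>
        cmod ((\<integral>x. of_real (s x) * f (tail_map X n x) \<partial>M)
              - of_real (\<integral>x. s x \<partial>M) * (\<integral>x. f (tail_map X n x) \<partial>M))
          \<le> nrm s * Lp_norm M \<infinity> (\<lambda>x. f (tail_map X n x)) * \<delta> n)"

definition partial_sum ::
    "(nat \<Rightarrow> 'e \<Rightarrow> 'x) \<Rightarrow> (nat \<Rightarrow> (nat \<Rightarrow> 'x) \<Rightarrow> 'b::comm_monoid_add) \<Rightarrow> nat \<Rightarrow> 'e \<Rightarrow> 'b" where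
  "partial_sum X g n x = (\<Sum>j<n. g j (tail_map X j x))"

text \<open>
  The library's \<^const>\<open>weak_conv_m\<close> is confined to laws on the real line. The limit \<open>L\<close> is
  a Borel probability law, so no mass may escape to infinity.
\<close>

definition converges_in_distribution ::
    "'e measure \<Rightarrow> (nat \<Rightarrow> 'e \<Rightarrow> 'b::topological_space) \<Rightarrow> 'b measure \<Rightarrow> bool" where
  "converges_in_distribution M Z L \<longleftrightarrow>
     prob_space L \<and> sets L = sets borel \<and>
     (\<forall>h :: 'b \<Rightarrow> real. continuous_on UNIV h \<and> bounded (range h) \<longrightarrow>
        (\<lambda>n. \<integral>z. h z \<partial>distr M borel (Z n)) \<longlonglongrightarrow> (\<integral>z. h z \<partial>L))"

end

theory Submission
  imports Defs
begin

text \<open>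
  Fix a bounded Lipschitz test function \<open>h\<close> and an index \<open>k\<close>. Since \<open>S\<^sub>k / b\<^sub>n \<rightarrow> 0\<close> pointwise,
  dominated convergence allows \<open>h (S\<^sub>n / b\<^sub>n)\<close> to be replaced by \<open>h ((S\<^sub>n - S\<^sub>k) / b\<^sub>n)\<close>, a bounded
  function of the coordinates from \<open>k\<close> on. Approximating \<open>r\<close> by \<open>s \<in> B\<close> in \<open>L\<^sup>p\<close>, hence in
  \<open>L\<^sup>1\<close>, the decay of correlations shows that the \<open>\<mu>\<close>-integrals with and without the weight \<open>r\<close>
  differ by a quantity that vanishes as \<open>k \<rightarrow> \<infinity>\<close>. So \<open>S\<^sub>n / b\<^sub>n\<close> has asymptotically the same
  Lipschitz expectations under \<open>\<mu>\<close> and \<open>\<nu>\<close>, and such expectations determine convergence in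
  distribution.
\<close>

subsection \<open>Lipschitz test functions\<close>

text \<open>The Pasch-Hausdorff envelope: for bounded \<open>h\<close> and \<open>K \<ge> 0\<close>,
  it is the largest \<open>K\<close>-Lipschitz function below \<open>h\<close>.\<close>

definition Lipschitz_minorant :: "('b::metric_space \<Rightarrow> real) \<Rightarrow> real \<Rightarrow> 'b \<Rightarrow> real" where
  "Lipschitz_minorant h K x = (INF y. h y + K * dist x y)"

context
  fixes h :: "'b::metric_space \<Rightarrow> real" and C K :: real
  assumes bound: "\<And>x. \<bar>h x\<bar> \<le> C" and K: "0 \<le> K"
begin

text \<open>A real infimum is a lower bound only when the range is bounded below; here
  \<open>- C\<close> bounds it, since the penalty \<open>K * dist x y\<close> is
  nonnegative.\<close>

lemma bdd_below_Lipschitz_minorant: "bdd_below (range (\<lambda>y. h y + K * dist x y))"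
proof (rule bdd_belowI2)
  fix y
  have "- C \<le> h y" "0 \<le> K * dist x y"
    using bound[of y] K by (auto simp: abs_le_iff)
  then show "- C \<le> h y + K * dist x y"
    by linarith
qed

lemma Lipschitz_minorant_le: "Lipschitz_minorant h K x \<le> h y + K * dist x y"
  unfolding Lipschitz_minorant_def
  by (rule cINF_lower[OF bdd_below_Lipschitz_minorant]) simp

lemma Lipschitz_minorant_le_self: "Lipschitz_minorant h K x \<le> h x"
  using Lipschitz_minorant_le[of x x] by simp

lemma abs_Lipschitz_minorant_le: "\<bar>Lipschitz_minorant h K x\<bar> \<le> C"
proof -
  have "- C \<le> h y + K * dist x y" for y
  proof -
    have "- C \<le> h y" "0 \<le> K * dist x y"
      using bound[of y] K by (auto simp: abs_le_iff)
    then show ?thesis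
      by linarith
  qed
  then have "- C \<le> Lipschitz_minorant h K x"
    unfolding Lipschitz_minorant_def by (intro cINF_greatest) auto
  moreover have "Lipschitz_minorant h K x \<le> C"
    using Lipschitz_minorant_le_self[of x] bound[of x] by linarith
  ultimately show ?thesis
    by linarith
qed

text \<open>An infimum of \<open>K\<close>-Lipschitz functions is \<open>K\<close>-Lipschitz. The
  triangle inequality gives the one-sided estimate, and exchanging \<open>x\<close> and
  \<open>y\<close> gives the other side.\<close>

lemma lipschitz_on_Lipschitz_minorant: "K-lipschitz_on UNIV (Lipschitz_minorant h K)"
proof -
  have *: "Lipschitz_minorant h K x \<le> Lipschitz_minorant h K y + K * dist x y" for x y
  proof -
    have "Lipschitz_minorant h K x - K * dist x y \<le> h z + K * dist y z" for z
    proof -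
      have "K * dist x z \<le> K * (dist x y + dist y z)"
        by (intro mult_left_mono dist_triangle K)
      then show ?thesis
        using Lipschitz_minorant_le[of x z] by (simp add: algebra_simps)
    qed
    then have "Lipschitz_minorant h K x - K * dist x y \<le> Lipschitz_minorant h K y"
      unfolding Lipschitz_minorant_def[of h K y] by (intro cINF_greatest) auto
    then show ?thesis
      by linarith
  qed
  show ?thesis
  proof (rule lipschitz_onI[OF _ K])
    fix x y
    show "dist (Lipschitz_minorant h K x) (Lipschitz_minorant h K y) \<le> K * dist x y"
      using *[of x y] *[of y x] by (simp add: dist_real_def dist_commute abs_le_iff)
  qed
qed

end

text \<open>Near \<open>x\<close>, continuity keeps \<open>h y\<close> above
  \<open>h x - e / 2\<close>; away from \<open>x\<close>, the penalty eventually exceeds the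
  oscillation \<open>2 * C\<close> of \<open>h\<close>, so distant points cannot lower the
  infimum.\<close>

lemma Lipschitz_minorant_tendsto:
  fixes h :: "'b::metric_space \<Rightarrow> real"
  assumes bound: "\<And>x. \<bar>h x\<bar> \<le> C" and cont: "continuous_on UNIV h"
  shows "(\<lambda>k. Lipschitz_minorant h (real k) x) \<longlonglongrightarrow> h x"
proof (rule LIMSEQ_I)
  fix e :: real assume "0 < e"
  have "isCont h x"
    using cont by (simp add: continuous_on_eq_continuous_at)
  then obtain d where d: "0 < d" "\<And>y. dist y x < d \<Longrightarrow> dist (h y) (h x) < e / 2"
    using \<open>0 < e\<close> unfolding continuous_at_eps_delta dist_norm by (meson half_gt_zero)
  \<comment> \<open>Chosen so that for \<open>k \<ge> k0\<close> the penalty is at least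
    \<open>2 * C\<close> outside the ball of radius \<open>d\<close>.\<close>
  obtain k0 :: nat where k0: "2 * C / d \<le> real k0"
    using real_arch_simple by blast
  have "norm (Lipschitz_minorant h (real k) x - h x) < e" if k: "k0 \<le> k" for k
  proof -
    have "h x - e / 2 \<le> h y + real k * dist x y" for y
    proof (cases "dist y x < d")
      case True
      have "0 \<le> real k * dist x y"
        by simp
      moreover have "h x - h y < e / 2"
        using d(2)[OF True] unfolding dist_real_def by linarith
      ultimately show ?thesis
        by linarith
    next
      case False
      have "2 * C \<le> real k * d"
        using k0 k d(1) by (simp add: field_simps) (smt (verit) mult_left_mono of_nat_mono)
      also have "\<dots> \<le> real k * dist x y"
        using False by (intro mult_left_mono) (auto simp: dist_commute)
      finally show ?thesis
        using bound[of x] bound[of y] \<open>0 < e\<close> by (simp add: abs_le_iff)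
    qed
    then have "h x - e / 2 \<le> Lipschitz_minorant h (real k) x"
      unfolding Lipschitz_minorant_def by (intro cINF_greatest) auto
    moreover have "Lipschitz_minorant h (real k) x \<le> h x"
      by (rule Lipschitz_minorant_le_self[OF bound]) simp
    ultimately show ?thesis
      using \<open>0 < e\<close> by simp
  qed
  then show "\<exists>k0. \<forall>k\<ge>k0. norm (Lipschitz_minorant h (real k) x - h x) < e"
    by blast
qed

lemma integrable_bounded_continuous:
  fixes h :: "'b::topological_space \<Rightarrow> real"
  assumes "finite_measure L" "sets L = sets borel" "continuous_on UNIV h" "\<And>x. \<bar>h x\<bar> \<le> C"
  shows "integrable L h"
proof -
  interpret finite_measure L by fact
  have "h \<in> borel_measurable L"
    using borel_measurable_continuous_onI[OF assms(3)] assms(2)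
    by (simp cong: measurable_cong_sets)
  then show ?thesis
    using assms(4) by (intro integrable_const_bound[where B = C]) auto
qed

text \<open>The lower half of weak convergence. By dominated convergence some Lipschitz minorant of
  \<open>h\<close> already has \<open>L\<close>-integral above \<open>a\<close>; the Lipschitz tests
  carry this to \<open>Q n\<close> for large \<open>n\<close>, and passing back from the minorant to
  \<open>h\<close> only increases the integral.\<close>

lemma eventually_integral_gt_of_Lipschitz_tests:
  fixes h :: "'b::metric_space \<Rightarrow> real"
  assumes Q: "\<And>n. prob_space (Q n)" "\<And>n. sets (Q n) = sets borel"
    and L: "prob_space L" "sets L = sets borel"
    and lip: "\<And>(h :: 'b \<Rightarrow> real) K C. K-lipschitz_on UNIV h \<Longrightarrow> (\<And>x. \<bar>h x\<bar> \<le> C) \<Longrightarrow>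
      (\<lambda>n. \<integral>z. h z \<partial>Q n) \<longlonglongrightarrow> (\<integral>z. h z \<partial>L)"
    and cont: "continuous_on UNIV h" and bound: "\<And>x. \<bar>h x\<bar> \<le> C"
    and a: "a < (\<integral>z. h z \<partial>L)"
  shows "\<forall>\<^sub>F n in sequentially. a < (\<integral>z. h z \<partial>Q n)"
proof -
  interpret L: prob_space L by fact
  have fin: "finite_measure (Q n)" "finite_measure L" for n
    using Q(1)[of n] L(1) by (simp_all add: prob_space.finite_measure)
  let ?m = "\<lambda>k. Lipschitz_minorant h (real k)"
  have lip_m: "(real k)-lipschitz_on UNIV (?m k)" for k
    by (rule lipschitz_on_Lipschitz_minorant[OF bound]) simp
  have bound_m: "\<bar>?m k x\<bar> \<le> C" for k x
    by (rule abs_Lipschitz_minorant_le[OF bound]) simp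
  have int_m: "integrable L (?m k)" "integrable (Q n) (?m k)" for k n
    using fin L(2) Q(2) lipschitz_on_continuous_on[OF lip_m] bound_m
    by (auto intro!: integrable_bounded_continuous)
  have int_h: "integrable L h" "integrable (Q n) h" for n
    using fin L(2) Q(2) cont bound by (auto intro!: integrable_bounded_continuous)
  have "(\<lambda>k. \<integral>z. ?m k z \<partial>L) \<longlonglongrightarrow> (\<integral>z. h z \<partial>L)"
    using int_m(1) int_h(1) bound_m Lipschitz_minorant_tendsto[OF bound cont]
    by (intro integral_dominated_convergence[where w = "\<lambda>_. C"]) auto
  then have "\<forall>\<^sub>F k in sequentially. a < (\<integral>z. ?m k z \<partial>L)"
    using a by (rule order_tendstoD)
  then obtain k where "a < (\<integral>z. ?m k z \<partial>L)"
    by (auto simp: eventually_sequentially)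
  then have "\<forall>\<^sub>F n in sequentially. a < (\<integral>z. ?m k z \<partial>Q n)"
    using lip[OF lip_m bound_m] by (rule order_tendstoD(1)[rotated])
  then show ?thesis
  proof eventually_elim
    case (elim n)
    have "(\<integral>z. ?m k z \<partial>Q n) \<le> (\<integral>z. h z \<partial>Q n)"
      by (intro integral_mono int_m int_h Lipschitz_minorant_le_self[OF bound]) simp
    with elim show ?case
      by linarith
  qed
qed

lemma converges_in_distribution_of_Lipschitz_tests:
  fixes Z :: "nat \<Rightarrow> 'e \<Rightarrow> 'b::metric_space"
  assumes M: "prob_space M" and Z: "\<And>n. Z n \<in> borel_measurable M"
    and L: "prob_space L" "sets L = sets borel"
    and lip: "\<And>(h :: 'b \<Rightarrow> real) K C. K-lipschitz_on UNIV h \<Longrightarrow> (\<And>x. \<bar>h x\<bar> \<le> C) \<Longrightarrow>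
      (\<lambda>n. \<integral>z. h z \<partial>distr M borel (Z n)) \<longlonglongrightarrow> (\<integral>z. h z \<partial>L)"
  shows "converges_in_distribution M Z L"
  unfolding converges_in_distribution_def
proof (intro conjI allI impI L)
  fix h :: "'b \<Rightarrow> real"
  assume h: "continuous_on UNIV h \<and> bounded (range h)"
  then obtain C where C: "\<And>x. \<bar>h x\<bar> \<le> C"
    by (auto simp: bounded_iff)
  have Q: "prob_space (distr M borel (Z n))" for n
    using M Z by (rule prob_space.prob_space_distr)
  \<comment> \<open>Stated for arbitrary \<open>f\<close> so that it serves both \<open>h\<close>
    and \<open>- h\<close>; the latter gives the upper half of the limit.\<close>
  have ev: "\<forall>\<^sub>F n in sequentially. a < (\<integral>z. f z \<partial>distr M borel (Z n))"
    if "continuous_on UNIV f" "\<And>x. \<bar>f x\<bar> \<le> C" "a < (\<integral>z. f z \<partial>L)" for f a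
    by (rule eventually_integral_gt_of_Lipschitz_tests[OF Q _ L lip that]) auto
  show "(\<lambda>n. \<integral>z. h z \<partial>distr M borel (Z n)) \<longlonglongrightarrow> (\<integral>z. h z \<partial>L)"
  proof (rule order_tendstoI)
    fix a assume "a < (\<integral>z. h z \<partial>L)"
    then show "\<forall>\<^sub>F n in sequentially. a < (\<integral>z. h z \<partial>distr M borel (Z n))"
      using h C by (intro ev) auto
  next
    fix a assume "(\<integral>z. h z \<partial>L) < a"
    then have "\<forall>\<^sub>F n in sequentially. - a < (\<integral>z. - h z \<partial>distr M borel (Z n))"
      using h C by (intro ev) (auto intro: continuous_intros)
    then show "\<forall>\<^sub>F n in sequentially. (\<integral>z. h z \<partial>distr M borel (Z n)) < a"
      by simp
  qed
qed

text \<open>Closed sets form an intersection-stable generator of the Borel sets, and the measure of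
  a closed set is a limit of integrals of bounded continuous functions.\<close>

lemma measure_eqI_bounded_continuous:
  fixes L L' :: "'b::metric_space measure"
  assumes L: "prob_space L" "sets L = sets borel" and L': "prob_space L'" "sets L' = sets borel"
    and eq: "\<And>h :: 'b \<Rightarrow> real. continuous_on UNIV h \<Longrightarrow> bounded (range h) \<Longrightarrow>
      (\<integral>z. h z \<partial>L) = (\<integral>z. h z \<partial>L')"
  shows "L = L'"
proof (rule measure_eqI_generator_eq[where E = "Collect closed" and \<Omega> = UNIV and A = "\<lambda>_. UNIV"])
  interpret L: prob_space L by fact
  interpret L': prob_space L' by fact
  show "Int_stable (Collect (closed :: 'b set \<Rightarrow> bool))"
    by (auto simp: Int_stable_def)
  show "sets L = sigma_sets UNIV (Collect closed)" "sets L' = sigma_sets UNIV (Collect closed)"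
    using L(2) L'(2) by (simp_all add: borel_eq_closed)
  show "emeasure L UNIV \<noteq> \<infinity>"
    by simp
  fix A :: "'b set" assume "A \<in> Collect closed"
  then have A: "closed A" by simp
  show "emeasure L A = emeasure L' A"
  proof (cases "A = {}")
    case False
    \<comment> \<open>These functions decrease to the indicator of the closed set \<open>A\<close>.
      The empty set is treated apart because \<open>infdist x {}\<close> is \<open>0\<close> by
      convention, which would make every \<open>f k\<close> equal to \<open>1\<close>.\<close>
    define f where "f k x = max 0 (1 - real k * infdist x A)" for k x
    have cont: "continuous_on UNIV (f k)" for k
      unfolding f_def by (intro continuous_intros)
    have bound: "\<bar>f k x\<bar> \<le> 1" for k x
      by (auto simp: f_def infdist_nonneg)
    have bdd: "bounded (range (f k))" for k
      using bound by (auto simp: bounded_iff)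
    have lim: "(\<lambda>k. f k x) \<longlonglongrightarrow> indicator A x" for x
    proof (cases "x \<in> A")
      case True
      then show ?thesis by (simp add: f_def)
    next
      case nA: False
      then have pos: "0 < infdist x A"
        using infdist_pos_not_in_closed[OF A False] by simp
      obtain k0 :: nat where "1 / infdist x A \<le> real k0"
        using real_arch_simple by blast
      then have k0: "1 \<le> real k0 * infdist x A"
        using pos by (simp add: field_simps)
      have "f k x = 0" if "k0 \<le> k" for k
      proof -
        have "real k0 * infdist x A \<le> real k * infdist x A"
          using that pos by (intro mult_right_mono) auto
        with k0 show ?thesis
          by (simp add: f_def)
      qed
      then have "\<forall>\<^sub>F k in sequentially. f k x = 0"
        by (auto simp: eventually_sequentially)
      then show ?thesis
        using nA by (simp add: tendsto_eventually)
    qed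
    have conv: "(\<lambda>k. \<integral>z. f k z \<partial>P) \<longlonglongrightarrow> measure P A"
      if P: "prob_space P" "sets P = sets borel" for P
    proof -
      interpret P: prob_space P by fact
      have "(\<lambda>k. \<integral>z. f k z \<partial>P) \<longlonglongrightarrow> (\<integral>z. indicator A z \<partial>P)"
      proof (rule integral_dominated_convergence[where w = "\<lambda>_. 1"])
        show "indicator A \<in> borel_measurable P"
          using A P(2) by (intro borel_measurable_indicator) simp
        show "f k \<in> borel_measurable P" for k
          using integrable_bounded_continuous[OF P.finite_measure_axioms P(2) cont bound]
          by (rule borel_measurable_integrable)
      qed (use lim bound in auto)
      then show ?thesis
        using sets_eq_imp_space_eq[OF P(2)] by simp
    qed
    have "measure L A = measure L' A"
      using conv[OF L] conv[OF L'] eq[OF cont bdd] by (auto intro: LIMSEQ_unique)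
    then show ?thesis
      by (simp add: L.emeasure_eq_measure L'.emeasure_eq_measure)
  qed simp
qed auto

lemma converges_in_distribution_unique:
  fixes Z :: "nat \<Rightarrow> 'e \<Rightarrow> 'b::metric_space"
  assumes "converges_in_distribution M Z L" "converges_in_distribution M Z L'"
  shows "L = L'"
  using assms unfolding converges_in_distribution_def
  by (intro measure_eqI_bounded_continuous) (auto intro: LIMSEQ_unique)

subsection \<open>Approximation in the mean\<close>

text \<open>Both reciprocals are nonnegative, so \<open>1 / p \<le> 1\<close>, which excludes
  \<open>p < 1\<close>, including \<open>p = 0\<close> with \<open>1 / p = \<infinity>\<close>. This
  is what lets approximation in the \<open>p\<close>-norm pass to approximation in the mean.\<close>

lemma conjugate_exponents_ge_one:
  assumes "conjugate_exponents p q"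
  shows "1 \<le> p"
proof (rule ccontr)
  assume "\<not> 1 \<le> p"
  then have "p < 1" by simp
  have "1 < 1 / p"
  proof (cases "p = 0")
    case False
    then obtain x where "p = ennreal x" "0 < x" "x < 1"
      using \<open>p < 1\<close> by (cases p) (auto simp: ennreal_less_iff simp flip: ennreal_1)
    then show ?thesis
      by (simp add: divide_ennreal ennreal_less_iff flip: ennreal_1)
  qed (simp add: ennreal_divide_zero)
  moreover have "1 / p \<le> 1"
    using assms unfolding conjugate_exponents_def by (metis add_increasing2 order_refl zero_le)
  ultimately show False
    by simp
qed

text \<open>For \<open>p = \<infinity>\<close> the essential supremum is subadditive. For finite
  \<open>p\<close>, bounding the norm of the difference by twice the maximum gives a pointwise
  estimate valid for every exponent \<open>a \<ge> 0\<close>, convex or not.\<close>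

lemma Lp_space_diff:
  fixes f g :: "'e \<Rightarrow> 'b::{real_normed_vector, second_countable_topology}"
  assumes f: "f \<in> Lp_space M p" and g: "g \<in> Lp_space M p"
  shows "(\<lambda>x. f x - g x) \<in> Lp_space M p"
proof -
  have [measurable]: "f \<in> borel_measurable M" "g \<in> borel_measurable M"
    using f g by (auto simp: Lp_space_def)
  show ?thesis
  proof (cases "p = \<infinity>")
    case True
    have "esssup M (\<lambda>x. ereal (norm (f x - g x)))
        \<le> esssup M (\<lambda>x. ereal (norm (f x)) + ereal (norm (g x)))"
      by (intro esssup_mono) (auto intro: norm_triangle_ineq4)
    also have "\<dots> \<le> esssup M (\<lambda>x. ereal (norm (f x))) + esssup M (\<lambda>x. ereal (norm (g x)))"
      by (rule esssup_add)
    also have "\<dots> < \<infinity>"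
      using f g True by (auto simp: Lp_space_def)
    finally show ?thesis
      using True by (simp add: Lp_space_def)
  next
    case False
    define a where "a = enn2real p"
    have "0 \<le> a" by (simp add: a_def)
    have bd: "norm (f x - g x) powr a \<le> 2 powr a * (norm (f x) powr a + norm (g x) powr a)" for x
    proof -
      have "norm (f x - g x) \<le> 2 * max (norm (f x)) (norm (g x))"
        using norm_triangle_ineq4[of "f x" "g x"] by linarith
      then have "norm (f x - g x) powr a \<le> (2 * max (norm (f x)) (norm (g x))) powr a"
        using \<open>0 \<le> a\<close> by (intro powr_mono2) auto
      also have "\<dots> = 2 powr a * max (norm (f x)) (norm (g x)) powr a"
        by (simp add: powr_mult)
      also have "\<dots> \<le> 2 powr a * (norm (f x) powr a + norm (g x) powr a)"
        by (intro mult_left_mono) (auto simp: max_def)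
      finally show ?thesis .
    qed
    have "integrable M (\<lambda>x. 2 powr a * (norm (f x) powr a + norm (g x) powr a))"
      using f g False by (auto simp: Lp_space_def a_def)
    then have "integrable M (\<lambda>x. norm (f x - g x) powr a)"
      by (rule Bochner_Integration.integrable_bound) (use bd in auto)
    then show ?thesis
      using False by (simp add: Lp_space_def a_def)
  qed
qed

text \<open>Membership in \<open>Lp_space\<close> rules out the value \<open>\<infinity>\<close> of
  the essential supremum, so \<open>real_of_ereal\<close> does not collapse it to
  \<open>0\<close>.\<close>

lemma AE_norm_le_Lp_norm_infinity:
  assumes "prob_space M" "f \<in> Lp_space M \<infinity>"
  shows "AE x in M. norm (f x) \<le> Lp_norm M \<infinity> f"
proof -
  interpret prob_space M by fact
  have "AE x in M. ereal (norm (f x)) \<le> esssup M (\<lambda>x. ereal (norm (f x)))"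
    by (rule esssup_AE)
  then show ?thesis
  proof eventually_elim
    case (elim x)
    with assms(2) show ?case
      by (cases "esssup M (\<lambda>x. ereal (norm (f x)))") (auto simp: Lp_norm_def Lp_space_def)
  qed
qed

text \<open>A constant statement holding almost everywhere on a probability space holds outright, so
  the essential supremum is nonnegative. If it is infinite, \<open>real_of_ereal\<close> returns
  \<open>0\<close>, which is harmless.\<close>

lemma Lp_norm_infinity_nonneg:
  assumes "prob_space M"
  shows "0 \<le> Lp_norm M \<infinity> f"
proof -
  interpret prob_space M by fact
  have "AE x in M. ereal (norm (f x)) \<le> esssup M (\<lambda>x. ereal (norm (f x)))"
    by (rule esssup_AE)
  then have "AE x in M. 0 \<le> esssup M (\<lambda>x. ereal (norm (f x)))"
    by eventually_elim (erule order_trans[rotated], simp)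
  then have "0 \<le> esssup M (\<lambda>x. ereal (norm (f x)))"
    by simp
  then show ?thesis
    by (simp add: Lp_norm_def real_of_ereal_pos)
qed

text \<open>The condition \<open>0 \<le> C\<close> covers the essential supremum
  \<open>- \<infinity>\<close> of a null measure, which \<open>real_of_ereal\<close> sends to
  \<open>0\<close>.\<close>

lemma Lp_norm_infinity_le:
  assumes "f \<in> borel_measurable M" "\<And>x. x \<in> space M \<Longrightarrow> norm (f x) \<le> C" "0 \<le> C"
  shows "Lp_norm M \<infinity> f \<le> C"
proof -
  have "esssup M (\<lambda>x. ereal (norm (f x))) \<le> ereal C"
    using assms by (intro esssup_I) auto
  then show ?thesis
    using assms(3) by (cases "esssup M (\<lambda>x. ereal (norm (f x)))") (auto simp: Lp_norm_def)
qed

text \<open>A crude substitute for the Hoelder inequality on a probability space. For finite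
  \<open>p\<close>, the integral is split pointwise into a constant \<open>\<epsilon>\<close> and a
  multiple of the \<open>a\<close>-th power of the norm that also integrates to at most
  \<open>\<epsilon>\<close>; hence the factor \<open>2\<close>.\<close>

lemma integral_norm_le_of_Lp_norm_less:
  assumes M: "prob_space M" and f: "f \<in> Lp_space M p" and p: "1 \<le> p"
    and \<epsilon>: "Lp_norm M p f < \<epsilon>"
  shows "(\<integral>x. norm (f x) \<partial>M) \<le> 2 * \<epsilon>"
proof -
  interpret prob_space M by fact
  have [measurable]: "f \<in> borel_measurable M"
    using f by (auto simp: Lp_space_def)
  show ?thesis
  proof (cases "p = \<infinity>")
    case True
    have AE: "AE x in M. norm (f x) \<le> \<epsilon>"
      using AE_norm_le_Lp_norm_infinity[OF M, of f] f \<epsilon> True by auto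
    then have "AE x in M. 0 \<le> \<epsilon>"
      by eventually_elim (use norm_ge_zero order_trans in blast)
    then have "0 \<le> \<epsilon>"
      by simp
    have "(\<integral>x. norm (f x) \<partial>M) \<le> (\<integral>x. \<epsilon> \<partial>M)"
      by (rule integral_mono_AE)
        (use AE in \<open>auto intro!: integrable_const_bound[where B = \<epsilon>]\<close>)
    with \<open>0 \<le> \<epsilon>\<close> show ?thesis
      by (simp add: prob_space)
  next
    case False
    define a where "a = enn2real p"
    have a: "1 \<le> a"
      using p False by (cases p) (auto simp: a_def simp flip: ennreal_1)
    define I where "I = (\<integral>x. norm (f x) powr a \<partial>M)"
    have int: "integrable M (\<lambda>x. norm (f x) powr a)"
      using f False by (simp add: Lp_space_def a_def)
    have I: "0 \<le> I" "I powr (1 / a) < \<epsilon>"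
      using \<epsilon> False by (auto simp: I_def Lp_norm_def a_def)
    then have "0 < \<epsilon>"
      using powr_ge_zero[of I "1 / a"] by linarith
    have "I = (I powr (1 / a)) powr a"
      using a I(1) by (simp add: powr_powr)
    also have "\<dots> \<le> \<epsilon> powr a"
      using I(2) a by (intro powr_mono2) auto
    finally have I_le: "I \<le> \<epsilon> powr a" .
    \<comment> \<open>where \<open>t > \<epsilon>\<close>, multiply \<open>t\<close> by \<open>(t / \<epsilon>) powr (a - 1) \<ge> 1\<close>\<close>
    have bd: "t \<le> \<epsilon> + \<epsilon> powr (1 - a) * t powr a" if "0 \<le> t" for t
    proof (cases "t \<le> \<epsilon>")
      case False
      then have "0 < t" using \<open>0 < \<epsilon>\<close> by linarith
      have "1 \<le> (t / \<epsilon>) powr (a - 1)"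
        using False a \<open>0 < \<epsilon>\<close> by (intro ge_one_powr_ge_zero) auto
      then have "t * 1 \<le> t * (t / \<epsilon>) powr (a - 1)"
        using that by (intro mult_left_mono)
      also have "\<dots> = \<epsilon> powr (1 - a) * t powr a"
        using \<open>0 < t\<close> \<open>0 < \<epsilon>\<close> by (simp add: powr_divide powr_diff field_simps)
      finally show ?thesis
        using \<open>0 < \<epsilon>\<close> by simp
    qed (use \<open>0 < \<epsilon>\<close> in \<open>simp add: add_increasing2\<close>)
    have int2: "integrable M (\<lambda>x. \<epsilon> + \<epsilon> powr (1 - a) * norm (f x) powr a)"
      using int by auto
    have "(\<integral>x. norm (f x) \<partial>M) \<le> (\<integral>x. \<epsilon> + \<epsilon> powr (1 - a) * norm (f x) powr a \<partial>M)"
      by (intro integral_mono Bochner_Integration.integrable_bound[OF int2])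
        (use bd \<open>0 < \<epsilon>\<close> in auto)
    also have "\<dots> = \<epsilon> + \<epsilon> powr (1 - a) * I"
      using int by (simp add: prob_space I_def)
    also have "\<dots> \<le> \<epsilon> + \<epsilon> powr (1 - a) * \<epsilon> powr a"
      using I_le by (intro add_left_mono mult_left_mono) auto
    also have "\<dots> = 2 * \<epsilon>"
      using \<open>0 < \<epsilon>\<close> by (simp flip: powr_add)
    finally show ?thesis .
  qed
qed

subsection \<open>Forgetting finitely many summands\<close>

lemma integrable_mult_bounded:
  fixes w u :: "'e \<Rightarrow> real"
  assumes w: "integrable M w" and u: "u \<in> borel_measurable M" and bound: "\<And>x. \<bar>u x\<bar> \<le> C"
  shows "integrable M (\<lambda>x. w x * u x)"
proof (rule Bochner_Integration.integrable_bound)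
  show "integrable M (\<lambda>x. C * w x)"
    using w by simp
  show "(\<lambda>x. w x * u x) \<in> borel_measurable M"
    using borel_measurable_integrable[OF w] u by (rule borel_measurable_times)
  have "\<bar>u x\<bar> * \<bar>w x\<bar> \<le> \<bar>C\<bar> * \<bar>w x\<bar>" for x
    using bound[of x] by (intro mult_right_mono) auto
  then show "AE x in M. norm (w x * u x) \<le> norm (C * w x)"
    by (simp add: abs_mult mult.commute)
qed

text \<open>Dominated convergence with majorant \<open>2 * C * norm (w x)\<close>. The weight may
  change sign; it will be \<open>r - 1\<close>.\<close>

lemma integral_Lipschitz_diff_tendsto_0:
  fixes h :: "'b::{real_normed_vector} \<Rightarrow> real"
  assumes w: "integrable M w" and lip: "K-lipschitz_on UNIV h" and bound: "\<And>x. \<bar>h x\<bar> \<le> C"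
    and T: "\<And>n. T n \<in> borel_measurable M" and V: "\<And>n. V n \<in> borel_measurable M"
    and close: "\<And>x. (\<lambda>n. dist (T n x) (V n x)) \<longlonglongrightarrow> 0"
  shows "(\<lambda>n. \<integral>x. w x * (h (T n x) - h (V n x)) \<partial>M) \<longlonglongrightarrow> 0"
proof -
  have h: "h \<in> borel_measurable borel"
    by (intro borel_measurable_continuous_onI lipschitz_on_continuous_on[OF lip])
  have "(\<lambda>n. \<integral>x. w x * (h (T n x) - h (V n x)) \<partial>M) \<longlonglongrightarrow> (\<integral>x. 0 \<partial>M)"
  proof (rule integral_dominated_convergence[where w = "\<lambda>x. 2 * C * norm (w x)"])
    show "(\<lambda>x. w x * (h (T n x) - h (V n x))) \<in> borel_measurable M" for n
      using borel_measurable_integrable[OF w] measurable_compose[OF T h] measurable_compose[OF V h]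
      by (intro borel_measurable_times borel_measurable_diff)
    show "integrable M (\<lambda>x. 2 * C * norm (w x))"
      using w by auto
    show "AE x in M. (\<lambda>n. w x * (h (T n x) - h (V n x))) \<longlonglongrightarrow> 0"
    proof (intro AE_I2 tendsto_mult_right_zero)
      fix x
      have "norm (h (T n x) - h (V n x)) \<le> K * dist (T n x) (V n x)" for n
        using lipschitz_onD[OF lip, of "T n x" "V n x"] by (simp add: dist_norm)
      moreover have "(\<lambda>n. K * dist (T n x) (V n x)) \<longlonglongrightarrow> 0"
        by (intro tendsto_mult_right_zero close)
      ultimately show "(\<lambda>n. h (T n x) - h (V n x)) \<longlonglongrightarrow> 0"
        by (rule Lim_null_comparison[OF always_eventually[OF allI]])
    qed
    show "AE x in M. norm (w x * (h (T n x) - h (V n x))) \<le> 2 * C * norm (w x)" for n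
    proof (rule AE_I2)
      fix x
      have "\<bar>h (T n x) - h (V n x)\<bar> \<le> 2 * C"
        using bound[of "T n x"] bound[of "V n x"] by linarith
      then have "\<bar>h (T n x) - h (V n x)\<bar> * \<bar>w x\<bar> \<le> 2 * C * \<bar>w x\<bar>"
        by (intro mult_right_mono) auto
      then show "norm (w x * (h (T n x) - h (V n x))) \<le> 2 * C * norm (w x)"
        by (simp add: abs_mult mult.commute)
    qed
  qed simp
  then show ?thesis
    by simp
qed

lemma measurable_tail_map:
  assumes "\<And>j. X j \<in> measurable M (N j)"
  shows "tail_map X n \<in> measurable M (tail_space N n)"
  unfolding tail_map_def[abs_def] tail_space_def
  by (rule measurable_PiM_single') (use assms measurable_space[OF assms] in \<open>auto simp: space_PiM PiE_iff\<close>)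

text \<open>Lets a function of the coordinates from \<open>n + i\<close> on be read as a function of
  the coordinates from \<open>n\<close> on.\<close>

lemma measurable_shift_tail_space:
  "(\<lambda>y l. y (i + l)) \<in> measurable (tail_space N n) (tail_space N (n + i))"
  unfolding tail_space_def
proof (rule measurable_PiM_single')
  fix l :: nat
  have "(\<lambda>y. y (i + l)) \<in> measurable (\<Pi>\<^sub>M k\<in>UNIV. N (n + k)) (N (n + (i + l)))"
    by (rule measurable_component_singleton) simp
  then show "(\<lambda>y. y (i + l)) \<in> measurable (\<Pi>\<^sub>M k\<in>UNIV. N (n + k)) (N (n + i + l))"
    by (simp add: add.assoc)
qed (auto simp: space_PiM PiE_iff add.assoc)

lemma tail_map_add: "tail_map X (n + i) x = (\<lambda>l. tail_map X n x (i + l))"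
  by (simp add: tail_map_def add.assoc)

text \<open>The complex-valued assumption applied to a real test function, with the essential
  supremum replaced by a uniform bound \<open>C\<close>.\<close>

lemma decay_of_correlations_real:
  fixes f :: "(nat \<Rightarrow> 'x) \<Rightarrow> real"
  assumes M: "prob_space M" and dc: "decay_of_correlations M N X B nrm \<delta>" and s: "s \<in> B"
    and X: "\<And>j. X j \<in> measurable M (N j)"
    and f: "f \<in> borel_measurable (tail_space N n)" and bound: "\<And>y. \<bar>f y\<bar> \<le> C"
  shows "\<bar>(\<integral>x. s x * f (tail_map X n x) \<partial>M) - (\<integral>x. s x \<partial>M) * (\<integral>x. f (tail_map X n x) \<partial>M)\<bar>
    \<le> nrm s * C * \<bar>\<delta> n\<bar>" (is "\<bar>?D\<bar> \<le> _")
proof -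
  have nrm: "0 \<le> nrm s"
    using dc s by (auto simp: decay_of_correlations_def)
  define F where "F y = complex_of_real (f y)" for y
  have F: "F \<in> borel_measurable (tail_space N n)" "bounded (F ` space (tail_space N n))"
    using f bound unfolding F_def[abs_def] by (auto simp: bounded_iff)
  have "cmod (of_real ?D)
      = cmod ((\<integral>x. of_real (s x) * F (tail_map X n x) \<partial>M)
              - of_real (\<integral>x. s x \<partial>M) * (\<integral>x. F (tail_map X n x) \<partial>M))"
    by (simp add: F_def flip: integral_complex_of_real)
  also have "\<dots> \<le> nrm s * Lp_norm M \<infinity> (\<lambda>x. F (tail_map X n x)) * \<delta> n"
    using dc s F unfolding decay_of_correlations_def by blast
  \<comment> \<open>\<open>\<delta>\<close> may take negative values; its absolute value makes the
    bound monotone in the supremum norm.\<close>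
  also have "\<dots> \<le> nrm s * Lp_norm M \<infinity> (\<lambda>x. F (tail_map X n x)) * \<bar>\<delta> n\<bar>"
    using nrm Lp_norm_infinity_nonneg[OF M] by (intro mult_left_mono mult_nonneg_nonneg) auto
  also have "\<dots> \<le> nrm s * C * \<bar>\<delta> n\<bar>"
  proof -
    have "Lp_norm M \<infinity> (\<lambda>x. F (tail_map X n x)) \<le> C"
      using measurable_compose[OF measurable_tail_map[OF X] F(1)] bound order_trans[OF abs_ge_zero bound]
      by (intro Lp_norm_infinity_le) (auto simp: F_def)
    then show ?thesis
      using nrm by (intro mult_right_mono mult_left_mono) auto
  qed
  finally show ?thesis
    by (simp only: norm_of_real)
qed

text \<open>The null sequence \<open>v\<close> may depend on \<open>e\<close>. This is the form
  required below, where the approximant \<open>s\<close> and the cut-off \<open>k\<close> are chosen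
  after \<open>e\<close>.\<close>

lemma tendsto_0_by_approximation:
  fixes u :: "nat \<Rightarrow> real"
  assumes "\<And>e. 0 < e \<Longrightarrow> \<exists>v. v \<longlonglongrightarrow> 0 \<and> (\<forall>\<^sub>F n in sequentially. \<bar>u n - v n\<bar> < e)"
  shows "u \<longlonglongrightarrow> 0"
proof (rule tendstoI)
  fix e :: real assume "0 < e"
  then obtain v where v: "v \<longlonglongrightarrow> 0" "\<forall>\<^sub>F n in sequentially. \<bar>u n - v n\<bar> < e / 2"
    using assms[of "e / 2"] by auto
  have "\<forall>\<^sub>F n in sequentially. dist (v n) 0 < e / 2"
    using v(1) \<open>0 < e\<close> by (intro tendstoD) auto
  with v(2) show "\<forall>\<^sub>F n in sequentially. dist (u n) 0 < e"
    by eventually_elim (unfold dist_real_def, linarith)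
qed

subsection \<open>Comparing the two laws\<close>

text \<open>Dropping the first \<open>k\<close> summands costs a null sequence \<open>v\<close>.
  What remains is a test function of the coordinates from \<open>k\<close> on, and its integral
  against \<open>r - 1\<close> splits into the error of replacing \<open>r\<close> by
  \<open>s\<close>, a correlation term, and the error in the mean of \<open>s\<close>.\<close>

lemma weighted_Lipschitz_expectation_tendsto_0:
  fixes g :: "nat \<Rightarrow> (nat \<Rightarrow> 'x) \<Rightarrow> 'b::{real_normed_vector, second_countable_topology}"
    and h :: "'b \<Rightarrow> real"
  assumes M: "prob_space M" and X: "\<And>j. X j \<in> measurable M (N j)"
    and dc: "decay_of_correlations M N X B nrm \<delta>"
    and g: "\<And>j. g j \<in> borel_measurable (tail_space N j)"
    and r: "integrable M r" "(\<integral>x. r x \<partial>M) = 1"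
    and approx: "\<And>e. 0 < e \<Longrightarrow> \<exists>s\<in>B. (\<integral>x. \<bar>r x - s x\<bar> \<partial>M) \<le> e"
    and b: "\<And>n. 0 < b n" "filterlim b at_top sequentially"
    and lip: "K-lipschitz_on UNIV h" and bound: "\<And>x. \<bar>h x\<bar> \<le> C"
  shows "(\<lambda>n. \<integral>x. (r x - 1) * h (partial_sum X g n x /\<^sub>R b n) \<partial>M) \<longlonglongrightarrow> 0"
proof (rule tendsto_0_by_approximation)
  interpret prob_space M by fact
  fix e :: real assume "0 < e"
  have "0 \<le> C"
    using order_trans[OF abs_ge_zero bound] .
  have h: "h \<in> borel_measurable borel"
    by (intro borel_measurable_continuous_onI lipschitz_on_continuous_on[OF lip])
  \<comment> \<open>The two errors from replacing \<open>r\<close> by \<open>s\<close> are at most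
    \<open>C * \<epsilon>\<close> each, hence at most \<open>e / 2\<close> together;
    \<open>C + 1\<close> keeps the denominator positive when \<open>C = 0\<close>.\<close>
  define \<epsilon> where "\<epsilon> = e / (4 * (C + 1))"
  have "0 < \<epsilon>" "2 * C * \<epsilon> \<le> e / 2"
    using \<open>0 < e\<close> \<open>0 \<le> C\<close> by (auto simp: \<epsilon>_def field_simps)
  obtain s where s: "s \<in> B" "(\<integral>x. \<bar>r x - s x\<bar> \<partial>M) \<le> \<epsilon>"
    using approx[OF \<open>0 < \<epsilon>\<close>] by blast
  have int_s: "integrable M s"
    using dc s(1) by (auto simp: decay_of_correlations_def)
  \<comment> \<open>The index \<open>k\<close> is fixed only after \<open>s\<close>, since
    \<open>nrm s\<close> is not controlled by the distance from \<open>s\<close> to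
    \<open>r\<close>.\<close>
  have "(\<lambda>k. nrm s * C * \<bar>\<delta> k\<bar>) \<longlonglongrightarrow> nrm s * C * \<bar>0\<bar>"
    using dc by (intro tendsto_intros) (auto simp: decay_of_correlations_def)
  then have "\<forall>\<^sub>F k in sequentially. nrm s * C * \<bar>\<delta> k\<bar> < e / 2"
    using \<open>0 < e\<close> by (intro order_tendstoD(2)) auto
  then obtain k where k: "nrm s * C * \<bar>\<delta> k\<bar> < e / 2"
    by (auto simp: eventually_sequentially)
  \<comment> \<open>\<open>f n\<close> and \<open>V n\<close> express the same truncated sum, on
    sequences and on the probability space. For \<open>n \<le> k\<close> the subtraction gives an
    empty sum; only large \<open>n\<close> matter for the limit.\<close>
  define f where "f n y = h ((\<Sum>i<n - k. g (k + i) (\<lambda>l. y (i + l))) /\<^sub>R b n)" for n y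
  define V where "V n x = (\<Sum>i<n - k. g (k + i) (tail_map X (k + i) x)) /\<^sub>R b n" for n x
  have h_V: "h (V n x) = f n (tail_map X k x)" for n x
    by (simp add: V_def f_def tail_map_add)
  have f: "f n \<in> borel_measurable (tail_space N k)" for n
    unfolding f_def
    by (intro measurable_compose[OF _ h] borel_measurable_scaleR borel_measurable_const
        borel_measurable_sum measurable_compose[OF measurable_shift_tail_space g])
  have g_X: "(\<lambda>x. g j (tail_map X j x)) \<in> borel_measurable M" for j
    by (rule measurable_compose[OF measurable_tail_map[OF X] g])
  define T where "T n x = partial_sum X g n x /\<^sub>R b n" for n x
  have T: "T n \<in> borel_measurable M" and V: "V n \<in> borel_measurable M" for n
    unfolding T_def partial_sum_def V_def
    by (intro borel_measurable_scaleR borel_measurable_const borel_measurable_sum g_X)+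
  have hT: "(\<lambda>x. h (T n x)) \<in> borel_measurable M"
    and hV: "(\<lambda>x. h (V n x)) \<in> borel_measurable M" for n
    by (rule measurable_compose[OF T h] measurable_compose[OF V h])+
  have int_mult: "integrable M (\<lambda>x. w x * u x)"
    if "integrable M w" "u \<in> borel_measurable M" "\<And>x. \<bar>u x\<bar> \<le> C" for w u :: "'a \<Rightarrow> real"
    using that by (rule integrable_mult_bounded)
  define v where "v n = (\<integral>x. (r x - 1) * (h (T n x) - h (V n x)) \<partial>M)" for n
  have "v \<longlonglongrightarrow> 0"
    unfolding v_def
  proof (rule integral_Lipschitz_diff_tendsto_0[OF _ lip bound T V])
    fix x
    \<comment> \<open>For \<open>n \<ge> k\<close> the difference is exactly the fixed initial sum
      divided by \<open>b n\<close>, which vanishes as \<open>b n\<close> grows.\<close>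
    have eq: "dist (T n x) (V n x) = norm (partial_sum X g k x) / b n" if "k \<le> n" for n
    proof -
      have "{..<n} = {..<k} \<union> {k..<n}" "{..<k} \<inter> {k..<n} = {}"
        using that by auto
      then have "partial_sum X g n x
          = partial_sum X g k x + (\<Sum>j=k..<n. g j (tail_map X j x))"
        by (simp add: partial_sum_def sum.union_disjoint)
      also have "(\<Sum>j=k..<n. g j (tail_map X j x)) = (\<Sum>i<n - k. g (k + i) (tail_map X (k + i) x))"
        using that sum.shift_bounds_nat_ivl[of "\<lambda>j. g j (tail_map X j x)" 0 k "n - k"]
        by (simp add: lessThan_atLeast0 add.commute)
      finally show ?thesis
        using b(1)[of n] by (simp add: T_def V_def dist_norm scaleR_add_right divide_inverse)
    qed
    have "(\<lambda>n. norm (partial_sum X g k x) / b n) \<longlonglongrightarrow> 0"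
      by (rule real_tendsto_divide_at_top[OF tendsto_const b(2)])
    then show "(\<lambda>n. dist (T n x) (V n x)) \<longlonglongrightarrow> 0"
      by (rule Lim_transform_eventually)
        (use eq in \<open>auto simp: eventually_sequentially intro!: exI[of _ k]\<close>)
  qed (use r in auto)
  moreover have "\<bar>(\<integral>x. (r x - 1) * h (T n x) \<partial>M) - v n\<bar> < e" for n
  proof -
    let ?u = "\<lambda>x. h (V n x)"
    have int: "integrable M (\<lambda>x. (r x - 1) * h (T n x))" "integrable M (\<lambda>x. (r x - 1) * ?u x)"
      "integrable M (\<lambda>x. (r x - s x) * ?u x)" "integrable M (\<lambda>x. s x * ?u x)" "integrable M ?u"
      using int_mult[OF _ hT bound] int_mult[OF _ hV bound] int_mult[OF _ hV bound, of "\<lambda>_. 1"]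
        r(1) int_s by auto
    have "(\<integral>x. (r x - 1) * h (T n x) \<partial>M) - v n = (\<integral>x. (r x - 1) * ?u x \<partial>M)"
      unfolding v_def right_diff_distrib using int by simp
    also have "\<dots> = (\<integral>x. (r x - s x) * ?u x + (s x * ?u x - ?u x) \<partial>M)"
      by (intro Bochner_Integration.integral_cong) (auto simp: algebra_simps)
    also have "\<dots> = (\<integral>x. (r x - s x) * ?u x \<partial>M)
        + ((\<integral>x. s x * ?u x \<partial>M) - (\<integral>x. ?u x \<partial>M))"
      using int(3-5) by simp
    \<comment> \<open>The product of the integrals of \<open>s\<close> and \<open>?u\<close> is
      inserted to expose the correlation; \<open>s\<close> need not have mean \<open>1\<close>,
      which leaves the last term.\<close>
    also have "\<dots> = (\<integral>x. (r x - s x) * ?u x \<partial>M)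
        + (((\<integral>x. s x * ?u x \<partial>M) - (\<integral>x. s x \<partial>M) * (\<integral>x. ?u x \<partial>M))
        + ((\<integral>x. s x \<partial>M) - 1) * (\<integral>x. ?u x \<partial>M))"
      by (simp add: left_diff_distrib)
    finally have split: "(\<integral>x. (r x - 1) * h (T n x) \<partial>M) - v n = \<dots>" .
    have "\<bar>\<integral>x. (r x - s x) * ?u x \<partial>M\<bar> \<le> (\<integral>x. \<bar>r x - s x\<bar> * C \<partial>M)"
      using int(3) integrable_abs[OF int(3)] r(1) int_s bound
      by (intro order_trans[OF integral_abs_bound] integral_mono)
        (auto simp: abs_mult intro!: mult_left_mono)
    also have "\<dots> \<le> C * \<epsilon>"
      using s(2) \<open>0 \<le> C\<close> by (simp add: mult.commute mult_left_mono)
    finally have 1: "\<bar>\<integral>x. (r x - s x) * ?u x \<partial>M\<bar> \<le> C * \<epsilon>" .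
    have 2: "\<bar>(\<integral>x. s x * ?u x \<partial>M) - (\<integral>x. s x \<partial>M) * (\<integral>x. ?u x \<partial>M)\<bar>
        \<le> nrm s * C * \<bar>\<delta> k\<bar>"
      unfolding h_V by (rule decay_of_correlations_real[OF M dc s(1) X f]) (simp add: f_def bound)
    \<comment> \<open>The \<open>1\<close> is the integral of \<open>r\<close>.\<close>
    have "\<bar>(\<integral>x. s x \<partial>M) - 1\<bar> = \<bar>\<integral>x. r x - s x \<partial>M\<bar>"
      using r int_s by simp
    also have "\<dots> \<le> (\<integral>x. \<bar>r x - s x\<bar> \<partial>M)"
      by (rule integral_abs_bound)
    finally have mean: "\<bar>(\<integral>x. s x \<partial>M) - 1\<bar> \<le> \<epsilon>"
      using s(2) by linarith
    have "\<bar>\<integral>x. ?u x \<partial>M\<bar> \<le> (\<integral>x. C \<partial>M)"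
      using int(5) bound by (intro order_trans[OF integral_abs_bound] integral_mono) auto
    then have "\<bar>\<integral>x. ?u x \<partial>M\<bar> \<le> C"
      by (simp add: prob_space)
    then have 3: "\<bar>((\<integral>x. s x \<partial>M) - 1) * (\<integral>x. ?u x \<partial>M)\<bar> \<le> \<epsilon> * C"
      unfolding abs_mult using mean \<open>0 < \<epsilon>\<close> by (intro mult_mono) auto
    show ?thesis
      unfolding split using 1 2 3 k \<open>2 * C * \<epsilon> \<le> e / 2\<close> by (simp add: algebra_simps)
  qed
  ultimately show "\<exists>v. v \<longlonglongrightarrow> 0
      \<and> (\<forall>\<^sub>F n in sequentially. \<bar>(\<integral>x. (r x - 1) * h (partial_sum X g n x /\<^sub>R b n) \<partial>M) - v n\<bar> < e)"
    unfolding T_def by (intro exI[of _ v]) auto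
qed

text \<open>The limit under \<open>P\<close>, plus a null difference, gives the limit under
  \<open>Q\<close> for each Lipschitz test. \<open>P\<close> and \<open>Q\<close> are kept general
  so that both directions of the equivalence are instances.\<close>

lemma converges_in_distribution_transfer:
  fixes Z :: "nat \<Rightarrow> 'e \<Rightarrow> 'b::metric_space"
  assumes Q: "prob_space Q" "\<And>n. Z n \<in> borel_measurable Q"
    and conv: "converges_in_distribution P Z L"
    and diff: "\<And>(h :: 'b \<Rightarrow> real) K C. K-lipschitz_on UNIV h \<Longrightarrow> (\<And>x. \<bar>h x\<bar> \<le> C) \<Longrightarrow>
      (\<lambda>n. (\<integral>z. h z \<partial>distr Q borel (Z n)) - (\<integral>z. h z \<partial>distr P borel (Z n))) \<longlonglongrightarrow> 0"
  shows "converges_in_distribution Q Z L"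
proof (rule converges_in_distribution_of_Lipschitz_tests[OF Q])
  show "prob_space L" "sets L = sets borel"
    using conv by (auto simp: converges_in_distribution_def)
  fix h :: "'b \<Rightarrow> real" and K C
  assume h: "K-lipschitz_on UNIV h" "\<And>x. \<bar>h x\<bar> \<le> C"
  have "(\<lambda>n. \<integral>z. h z \<partial>distr P borel (Z n)) \<longlonglongrightarrow> (\<integral>z. h z \<partial>L)"
    using conv lipschitz_on_continuous_on[OF h(1)] h(2)
    unfolding converges_in_distribution_def bounded_iff by auto
  from tendsto_add[OF diff[OF h] this]
  show "(\<lambda>n. \<integral>z. h z \<partial>distr Q borel (Z n)) \<longlonglongrightarrow> (\<integral>z. h z \<partial>L)"
    by simp
qed

theorem theorem3p1:
  fixes M :: "'e measure"
    and N :: "nat \<Rightarrow> 'x measure"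
    and X :: "nat \<Rightarrow> 'e \<Rightarrow> 'x"
    and B :: "('e \<Rightarrow> real) set"
    and nrm :: "('e \<Rightarrow> real) \<Rightarrow> real"
    and \<delta> :: "nat \<Rightarrow> real"
    and g :: "nat \<Rightarrow> (nat \<Rightarrow> 'x) \<Rightarrow> real ^ 'd"
    and r :: "'e \<Rightarrow> real"
    and \<nu> :: "'e measure"
    and p q :: ennreal
    and b :: "nat \<Rightarrow> real"
  assumes "prob_space M"
    and "\<And>j. X j \<in> measurable M (N j)"
    and "decay_of_correlations M N X B nrm \<delta>"
    and "\<And>j. g j \<in> borel_measurable (tail_space N j)"
    and "r \<in> borel_measurable M"
    and "\<And>x. x \<in> space M \<Longrightarrow> 0 \<le> r x"
    and "(\<integral>x. r x \<partial>M) = 1"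
    and "\<nu> = density M (\<lambda>x. ennreal (r x))"
    and "conjugate_exponents p q"
    and "r \<in> Lp_closure M p (B \<inter> Lp_space M p)"
    and "\<And>j. (\<lambda>x. g j (tail_map X j x)) \<in> Lp_space M q"
    and "\<And>n. 0 < b n"
    and "filterlim b at_top sequentially"
  shows "((\<exists>L. converges_in_distribution M (\<lambda>n x. partial_sum X g n x /\<^sub>R b n) L) \<longleftrightarrow>
          (\<exists>L. converges_in_distribution \<nu> (\<lambda>n x. partial_sum X g n x /\<^sub>R b n) L)) \<and>
         (\<forall>L L'. converges_in_distribution M (\<lambda>n x. partial_sum X g n x /\<^sub>R b n) L \<and>
                 converges_in_distribution \<nu> (\<lambda>n x. partial_sum X g n x /\<^sub>R b n) L' \<longrightarrow> L = L')"
proof -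
  interpret M: prob_space M by fact
  let ?Z = "\<lambda>n x. partial_sum X g n x /\<^sub>R b n"
  \<comment> \<open>The Bochner integral of a non-integrable function is \<open>0\<close> by
    convention, so the value \<open>1\<close> forces integrability.\<close>
  have r: "integrable M r"
    using assms(7) not_integrable_integral_eq by fastforce
  have "emeasure \<nu> (space \<nu>) = 1"
    using r assms(5-8) nn_integral_eq_integral[OF r]
    by (simp add: emeasure_density AE_I2 cong: nn_integral_cong)
  then have \<nu>: "prob_space \<nu>"
    by (rule prob_spaceI)
  have Z: "?Z n \<in> borel_measurable M" for n
    unfolding partial_sum_def
    by (intro borel_measurable_scaleR borel_measurable_const borel_measurable_sum
        measurable_compose[OF measurable_tail_map[OF assms(2)] assms(4)])
  have Z\<nu>: "?Z n \<in> borel_measurable \<nu>" for n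
    using Z[of n] assms(8) by simp
  \<comment> \<open>An approximation within \<open>e / 2\<close> in the \<open>p\<close>-norm
    absorbs the factor \<open>2\<close> lost in passing to the mean.\<close>
  have approx: "\<exists>s\<in>B. (\<integral>x. \<bar>r x - s x\<bar> \<partial>M) \<le> e" if "0 < e" for e
  proof -
    obtain s where s: "s \<in> B \<inter> Lp_space M p" "Lp_norm M p (\<lambda>x. r x - s x) < e / 2"
      using assms(10) \<open>0 < e\<close> unfolding Lp_closure_def by (auto dest: spec[of _ "e / 2"])
    have "(\<lambda>x. r x - s x) \<in> Lp_space M p"
      using assms(10) s(1) by (intro Lp_space_diff) (auto simp: Lp_closure_def)
    from integral_norm_le_of_Lp_norm_less[OF assms(1) this conjugate_exponents_ge_one[OF assms(9)] s(2)]
    show ?thesis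
      using s(1) by auto
  qed
  \<comment> \<open>An expectation under \<open>\<nu>\<close> is an expectation under
    \<open>M\<close> with weight \<open>r\<close>, so the difference of the two is the integral with
    weight \<open>r - 1\<close>.\<close>
  have diff: "(\<lambda>n. (\<integral>z. h z \<partial>distr \<nu> borel (?Z n)) - (\<integral>z. h z \<partial>distr M borel (?Z n))) \<longlonglongrightarrow> 0"
    if lip: "K-lipschitz_on UNIV h" and bound: "\<And>x. \<bar>h x\<bar> \<le> C" for h :: "real ^ 'd \<Rightarrow> real" and K C
  proof -
    have h: "h \<in> borel_measurable borel"
      by (intro borel_measurable_continuous_onI lipschitz_on_continuous_on[OF lip])
    have hZ: "(\<lambda>x. h (?Z n x)) \<in> borel_measurable M" for n
      by (rule measurable_compose[OF Z h])
    have int: "integrable M (\<lambda>x. h (?Z n x))" for n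
      using bound by (intro M.integrable_const_bound[where B = C] hZ) auto
    have int_r: "integrable M (\<lambda>x. r x * h (?Z n x))" for n
      using r hZ bound by (rule integrable_mult_bounded)
    have "(\<integral>z. h z \<partial>distr \<nu> borel (?Z n)) - (\<integral>z. h z \<partial>distr M borel (?Z n))
        = (\<integral>x. (r x - 1) * h (?Z n x) \<partial>M)" for n
    proof -
      have "(\<integral>z. h z \<partial>distr \<nu> borel (?Z n)) = (\<integral>x. h (?Z n x) \<partial>\<nu>)"
        by (rule integral_distr[OF Z\<nu> h])
      also have "\<dots> = (\<integral>x. r x * h (?Z n x) \<partial>M)"
        unfolding assms(8) using integral_density[OF hZ assms(5)] assms(6) by simp
      finally show ?thesis
        using int int_r by (simp add: integral_distr[OF Z h] left_diff_distrib)
    qed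
    then show ?thesis
      using weighted_Lipschitz_expectation_tendsto_0[OF assms(1) assms(2) assms(3) assms(4) r assms(7)
          approx assms(12) assms(13) lip bound] by simp
  qed
  have M_\<nu>: "converges_in_distribution \<nu> ?Z L" if "converges_in_distribution M ?Z L" for L
    by (rule converges_in_distribution_transfer[OF \<nu> Z\<nu> that diff])
  have \<nu>_M: "converges_in_distribution M ?Z L" if "converges_in_distribution \<nu> ?Z L" for L
  proof (rule converges_in_distribution_transfer[OF assms(1) Z that])
    fix h :: "real ^ 'd \<Rightarrow> real" and K C
    assume "K-lipschitz_on UNIV h" "\<And>x. \<bar>h x\<bar> \<le> C"
    from tendsto_minus[OF diff[OF this]]
    show "(\<lambda>n. (\<integral>z. h z \<partial>distr M borel (?Z n)) - (\<integral>z. h z \<partial>distr \<nu> borel (?Z n))) \<longlonglongrightarrow> 0"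
      by simp
  qed
  \<comment> \<open>A limit under \<open>M\<close> is also a limit under \<open>\<nu>\<close>, so
    uniqueness under \<open>\<nu>\<close> identifies the two limits.\<close>
  show ?thesis
    using M_\<nu> \<nu>_M converges_in_distribution_unique[of \<nu> ?Z] by blast
qed

end
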